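(* Let $A\in\mathbb R^{n\times n}$ be an M-matrix in Frobenius normal form, that is, $$A=\begin{bmatrix}A_{11}&A_{12}&\cdots&A_{1\nu}\\ &A_{22}&\ddots&\vdots\\ &&\ddots&\vdots\\ &&&A_{\nu\nu}\end{bmatrix}$$ is block upper triangular with irreducible square diagonal blocks $A_{ii}$, $i=1,\ldots,\nu$ (with $A_{ij}=0$ for $i>j$). There exists $\boldsymbol u\in\mathbb R^n$, $\boldsymbol u>0$, such that $A\boldsymbol u=0$ if and only if there exists at least one singular diagonal block and the following two conditions hold: (i) for every $i$, if $A_{ii}$ is singular, then $A_{ij}=0$ for all $j\ne i$; (ii) for every $i$, if $A_{ii}$ is nonsingular, then there exists $j\ne i$ such that $A_{ij}\ne 0$.
   Context: Inequalities between real matrices or vectors are entry-wise ($\boldsymbol u>0$ means all entries are positive). An M-matrix is a real square matrix of the form $\alpha I-B$ with $B\ge 0$ entry-wise, $\alpha>0$ and $\rho(B)\le\alpha$, where $\rho$ is the spectral radius. A square matrix of size at least $2$ is irreducible if no simultaneous permutation of its rows and columns puts it in block upper triangular form with at least two square diagonal blocks; every $1\times1$ matrix, including the zero $1\times 1$ matrix, is regarded as irreducible (so a $1\times1$ zero block is a singular irreducible block). *)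

theory Defs
  imports
    "Jordan_Normal_Form.Spectral_Radius"
    "Jordan_Normal_Form.DL_Submatrix"
begin

text \<open>A partition of the indices \<open>0, \<dots>, n - 1\<close> into consecutive blocks is encoded by the list
  \<open>ns\<close> of the block sizes. Blocks are numbered from \<open>0\<close> to \<open>length ns - 1\<close>.\<close>

definition block_indices :: "nat list \<Rightarrow> nat \<Rightarrow> nat set" where
  "block_indices ns i = {sum_list (take i ns)..<sum_list (take (Suc i) ns)}"

definition block :: "nat list \<Rightarrow> 'a mat \<Rightarrow> nat \<Rightarrow> nat \<Rightarrow> 'a mat" where
  "block ns A i j = submatrix A (block_indices ns i) (block_indices ns j)"

definition block_upper_triangular :: "nat list \<Rightarrow> 'a::zero mat \<Rightarrow> bool" where
  "block_upper_triangular ns A \<longleftrightarrow>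
     A \<in> carrier_mat (sum_list ns) (sum_list ns) \<and> (\<forall>m\<in>set ns. 0 < m) \<and>
     (\<forall>i<length ns. \<forall>j<i. block ns A i j = 0\<^sub>m (ns ! i) (ns ! j))"

definition permute_mat :: "(nat \<Rightarrow> nat) \<Rightarrow> 'a mat \<Rightarrow> 'a mat" where
  "permute_mat p A = mat (dim_row A) (dim_col A) (\<lambda>(i, j). A $$ (p i, p j))"

text \<open>Since blocks are nonempty, a \<open>1 \<times> 1\<close> matrix never splits into two blocks. Hence every
  \<open>1 \<times> 1\<close> matrix, including the zero matrix, is irreducible.\<close>

definition irreducible_mat :: "'a::zero mat \<Rightarrow> bool" where
  "irreducible_mat A \<longleftrightarrow> square_mat A \<and> 0 < dim_row A \<and>
     \<not> (\<exists>p ns. p permutes {..<dim_row A} \<and> 2 \<le> length ns \<and>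
          block_upper_triangular ns (permute_mat p A))"

definition frobenius_normal_form :: "nat list \<Rightarrow> 'a::zero mat \<Rightarrow> bool" where
  "frobenius_normal_form ns A \<longleftrightarrow>
     block_upper_triangular ns A \<and> (\<forall>i<length ns. irreducible_mat (block ns A i i))"

definition M_matrix :: "real mat \<Rightarrow> bool" where
  "M_matrix A \<longleftrightarrow> square_mat A \<and>
     (\<exists>\<alpha> B. 0 < \<alpha> \<and> B \<in> carrier_mat (dim_row A) (dim_row A) \<and>
        0\<^sub>m (dim_row A) (dim_row A) \<le> B \<and>
        spectral_radius (map_mat complex_of_real B) \<le> \<alpha> \<and>
        A = \<alpha> \<cdot>\<^sub>m 1\<^sub>m (dim_row A) - B)"

text \<open>Positivity of a vector is spelled out, because the library's strict order on vectors is
  \<open>v \<le> w \<and> \<not> w \<le> v\<close>, which is weaker than entrywise \<open><\<close>.\<close>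

definition positive_vec :: "real vec \<Rightarrow> bool" where
  "positive_vec u \<longleftrightarrow> (\<forall>i<dim_vec u. 0 < u $ i)"

end

theory Submission
  imports Defs
begin

text \<open>Write \<open>A = \<alpha> I - B\<close> with \<open>B \<ge> 0\<close>. Perron--Frobenius theory is avoided. The only
  consequence of \<open>\<rho>(B) \<le> \<alpha>\<close> that is used is: if \<open>x \<ge> 0\<close> and \<open>B x \<ge> c x\<close> with \<open>c > \<alpha>\<close>, then
  \<open>x = 0\<close>, because \<open>(B / d)\<^sup>k\<close> stays bounded for \<open>\<alpha> < d < c\<close>. For an irreducible diagonal block
  this gives that \<open>q \<ge> 0\<close> and \<open>B q \<ge> \<alpha> q\<close> force \<open>B q = \<alpha> q\<close>. Applied to \<open>q = \<bar>x\<bar>\<close> for a null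
  vector \<open>x\<close> it yields a positive null vector of a singular block; applied to the negative part
  of \<open>x = A\<^sub>i\<^sub>i\<^sup>-\<^sup>1 w\<close> it shows that a nonsingular block maps a nonzero \<open>w \<ge> 0\<close> to a positive
  vector. Back substitution, starting from the last block, then assembles \<open>u\<close>.

  Conversely, if \<open>A u = 0\<close> with \<open>u > 0\<close>, then \<open>A\<^sub>i\<^sub>i u\<^sub>i \<ge> 0\<close>, with equality iff all
  \<open>A\<^sub>i\<^sub>j\<close> with \<open>j \<noteq> i\<close> vanish. If equality fails, comparing any null vector of \<open>A\<^sub>i\<^sub>i\<close> with multiples of
  \<open>u\<^sub>i\<close> shows that \<open>A\<^sub>i\<^sub>i\<close> is nonsingular.\<close>

section \<open>Subinvariant vectors and the spectral radius\<close>

text \<open>Since \<open>R\<close> is nonnegative it preserves entrywise inequalities, so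
  \<open>y = R x\<close> inherits both \<open>y \<ge> 0\<close> and \<open>R y \<ge> g y\<close>.
  The induction hypothesis is therefore applied to \<open>y\<close>, which is why \<open>x\<close>
  is generalised.\<close>

lemma power_mult_vec_ge:
  fixes R :: "real mat"
  assumes R: "R \<in> carrier_mat n n" and R0: "\<And>i j. i < n \<Longrightarrow> j < n \<Longrightarrow> 0 \<le> R $$ (i, j)"
    and g: "0 \<le> g"
    and "x \<in> carrier_vec n" and "\<And>i. i < n \<Longrightarrow> 0 \<le> x $ i"
    and "\<And>i. i < n \<Longrightarrow> g * x $ i \<le> (R *\<^sub>v x) $ i"
    and "i < n"
  shows "g ^ k * x $ i \<le> ((R ^\<^sub>m k) *\<^sub>v x) $ i"
  using assms(4-7)
proof (induction k arbitrary: x i)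
  case 0
  then show ?case using R by simp
next
  case (Suc k)
  define y where "y = R *\<^sub>v x"
  have y: "y \<in> carrier_vec n" unfolding y_def using R Suc.prems by simp
  have le: "g * x $ j \<le> y $ j" if "j < n" for j using Suc.prems that by (simp add: y_def)
  have "g ^ k * y $ i \<le> ((R ^\<^sub>m k) *\<^sub>v y) $ i"
  proof (rule Suc.IH[OF y _ _ \<open>i < n\<close>])
    show "0 \<le> y $ j" if "j < n" for j
      using le[OF that] Suc.prems(2)[OF that] g by (meson mult_nonneg_nonneg order_trans)
    show "g * y $ j \<le> (R *\<^sub>v y) $ j" if j: "j < n" for j
    proof -
      have "g * y $ j = (\<Sum>l<n. R $$ (j, l) * (g * x $ l))"
        using R Suc.prems(1) j unfolding y_def
        by (simp add: scalar_prod_def sum_distrib_left lessThan_atLeast0 mult.left_commute)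
      also have "\<dots> \<le> (\<Sum>l<n. R $$ (j, l) * y $ l)"
        using le R0 j by (intro sum_mono mult_left_mono) auto
      also have "\<dots> = (R *\<^sub>v y) $ j"
        using R y j by (simp add: scalar_prod_def lessThan_atLeast0)
      finally show ?thesis .
    qed
  qed
  moreover have "g ^ Suc k * x $ i \<le> g ^ k * y $ i"
    using mult_left_mono[OF le[OF \<open>i < n\<close>], of "g ^ k"] g by (simp add: mult.assoc mult.left_commute)
  moreover have "(R ^\<^sub>m Suc k) *\<^sub>v x = (R ^\<^sub>m k) *\<^sub>v y"
    using R Suc.prems(1) by (simp add: y_def assoc_mult_mat_vec[of _ n n _ n])
  ultimately show ?case by simp
qed

text \<open>The uniform bound holds for the powers of the complexified matrix. Complexification
  commutes with powers and keeps the absolute values of the entries, so the bound descends to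
  \<open>R\<close>.\<close>

lemma spectral_radius_lt_1_imp_bounded_powers:
  fixes R :: "real mat"
  assumes R: "R \<in> carrier_mat n n"
    and ev: "spectral_radius (map_mat complex_of_real R) < 1"
  shows "\<exists>C. \<forall>k. \<forall>i<n. \<forall>j<n. \<bar>(R ^\<^sub>m k) $$ (i, j)\<bar> \<le> C"
proof -
  have "\<exists>C. \<forall>k. norm_bound (map_mat complex_of_real R ^\<^sub>m k) C"
    using R ev by (intro spectral_radius_jnf_norm_bound_less_1_upper_triangular[of _ n]) auto
  then obtain C where C: "\<And>k. norm_bound (map_mat complex_of_real R ^\<^sub>m k) C" by auto
  have "\<bar>(R ^\<^sub>m k) $$ (i, j)\<bar> \<le> C" if "i < n" "j < n" for k i j
  proof -
    have "map_mat complex_of_real R ^\<^sub>m k = map_mat complex_of_real (R ^\<^sub>m k)"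
      using of_real_hom.mat_hom_pow[OF R] by metis
    then show ?thesis using C[of k] that R unfolding norm_bound_def by simp
  qed
  then show ?thesis by blast
qed

text \<open>An eigenvalue \<open>e\<close> of \<open>M / c\<close> gives the eigenvalue
  \<open>c * e\<close> of \<open>M\<close> with the same eigenvector. This is used for an
  \<open>e\<close> of maximal modulus, which exists because \<open>0 < n\<close>.\<close>

lemma spectral_radius_smult_less_1:
  fixes M :: "complex mat"
  assumes M: "M \<in> carrier_mat n n" and n: "0 < n" and c: "0 < c" and lt: "spectral_radius M < c"
  shows "spectral_radius (complex_of_real (1 / c) \<cdot>\<^sub>m M) < 1"
proof -
  let ?N = "complex_of_real (1 / c) \<cdot>\<^sub>m M"
  have N: "?N \<in> carrier_mat n n" using M by simp
  obtain e where e: "eigenvalue ?N e" "spectral_radius ?N = norm e"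
    using spectral_radius_mem_max(1)[OF N n] unfolding spectrum_def by auto
  obtain v where v: "v \<in> carrier_vec n" "v \<noteq> 0\<^sub>v n" "?N *\<^sub>v v = e \<cdot>\<^sub>v v"
    using e(1) M unfolding eigenvalue_def eigenvector_def by auto
  have "M *\<^sub>v v = complex_of_real c \<cdot>\<^sub>v (?N *\<^sub>v v)"
    using M v(1) c by (intro eq_vecI) (auto simp: scalar_prod_def sum_distrib_left)
  also have "\<dots> = (complex_of_real c * e) \<cdot>\<^sub>v v" unfolding v(3) by (simp add: smult_smult_assoc)
  finally have "eigenvalue M (complex_of_real c * e)"
    using M v unfolding eigenvalue_def eigenvector_def by auto
  then have "norm (complex_of_real c * e) \<le> spectral_radius M"
    by (intro spectral_radius_mem_max(2)[OF M n]) (auto simp: spectrum_def)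
  then have "c * norm e < c * 1" using lt c by (simp only: norm_mult norm_of_real)
  then show ?thesis using c e(2) by (simp only: mult_less_cancel_left_pos)
qed

lemma subinvariant_vec_above_spectral_radius:
  fixes B :: "real mat"
  assumes B: "B \<in> carrier_mat n n" and B0: "\<And>i j. i < n \<Longrightarrow> j < n \<Longrightarrow> 0 \<le> B $$ (i, j)"
    and rho: "spectral_radius (map_mat complex_of_real B) \<le> \<alpha>" and \<alpha>: "0 < \<alpha>" "\<alpha> < c"
    and x: "\<And>i. i < n \<Longrightarrow> 0 \<le> x i"
    and le: "\<And>i. i < n \<Longrightarrow> c * x i \<le> (\<Sum>j<n. B $$ (i, j) * x j)"
    and i: "i < n"
  shows "x i = 0"
proof -
  \<comment> \<open>Any value strictly between works: \<open>\<alpha> < d\<close> makes the spectral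
    radius of \<open>B / d\<close> less than 1 even if that of \<open>B\<close> equals
    \<open>\<alpha>\<close>, and \<open>d < c\<close> makes the growth factor \<open>c / d\<close>
    exceed 1.\<close>
  define d where "d = (\<alpha> + c) / 2"
  have d: "0 < d" "\<alpha> < d" "d < c" using \<alpha> unfolding d_def by auto
  define R where "R = (1 / d) \<cdot>\<^sub>m B"
  have R: "R \<in> carrier_mat n n" unfolding R_def using B by simp
  have "map_mat complex_of_real R = complex_of_real (1 / d) \<cdot>\<^sub>m map_mat complex_of_real B"
    unfolding R_def by auto
  moreover have "spectral_radius (complex_of_real (1 / d) \<cdot>\<^sub>m map_mat complex_of_real B) < 1"
    using B i rho d by (intro spectral_radius_smult_less_1[of _ n]) auto
  ultimately obtain C where C: "\<And>k i j. i < n \<Longrightarrow> j < n \<Longrightarrow> \<bar>(R ^\<^sub>m k) $$ (i, j)\<bar> \<le> C"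
    using spectral_radius_lt_1_imp_bounded_powers[OF R] by metis
  have bound: "(c / d) ^ k * x i \<le> (\<Sum>j<n. C * x j)" for k
  proof -
    have "(c / d) ^ k * vec n x $ i \<le> ((R ^\<^sub>m k) *\<^sub>v vec n x) $ i"
    proof (rule power_mult_vec_ge[OF R _ _ _ _ _ i])
      show "0 \<le> R $$ (i, j)" if "i < n" "j < n" for i j
        using B0[OF that] that d B by (simp add: R_def)
      show "c / d * vec n x $ i \<le> (R *\<^sub>v vec n x) $ i" if "i < n" for i
      proof -
        have "(R *\<^sub>v vec n x) $ i = (\<Sum>j<n. B $$ (i, j) * x j) / d"
          using B that by (simp add: R_def scalar_prod_def lessThan_atLeast0 sum_divide_distrib)
        then show ?thesis using le[OF that] d that by (simp add: divide_right_mono)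
      qed
    qed (use d \<alpha> x in auto)
    also have "\<dots> = (\<Sum>j<n. (R ^\<^sub>m k) $$ (i, j) * x j)"
      using R i by (simp add: scalar_prod_def lessThan_atLeast0)
    also have "\<dots> \<le> (\<Sum>j<n. C * x j)"
      using C[OF i] x by (intro sum_mono mult_right_mono) (auto simp: abs_le_iff)
    finally show ?thesis using i by simp
  qed
  show "x i = 0"
  proof (rule ccontr)
    assume "x i \<noteq> 0"
    then have xi: "0 < x i" using x[OF i] by simp
    have "1 < c / d" using d by simp
    then obtain k where "(\<Sum>j<n. C * x j) / x i < (c / d) ^ k"
      using real_arch_pow by blast
    then show False using bound[of k] xi by (simp add: field_simps)
  qed
qed

section \<open>Irreducible nonnegative matrices\<close>

text \<open>Irreducibility is stated through the digraph of \<open>b\<close>: a nonempty set that no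
  edge leaves is everything. With an arbitrary index set in place of permutations, diagonal blocks
  keep their global indices. For a singleton \<open>S\<close> the condition holds automatically, so
  the zero block of size 1 is covered.\<close>

locale irreducible_nonneg =
  fixes S :: "'a set" and b :: "'a \<Rightarrow> 'a \<Rightarrow> real"
  assumes finite: "finite S"
    and nonneg: "\<And>k l. k \<in> S \<Longrightarrow> l \<in> S \<Longrightarrow> 0 \<le> b k l"
    and irred: "\<And>Z. Z \<subseteq> S \<Longrightarrow> Z \<noteq> {} \<Longrightarrow> (\<And>k l. k \<in> Z \<Longrightarrow> l \<in> S - Z \<Longrightarrow> b k l = 0) \<Longrightarrow> Z = S"
begin

text \<open>The set of zeros of a solution is closed under the edges of \<open>b\<close>, hence empty or
  everything.\<close>

lemma zero_or_positive:
  assumes x: "\<And>k. k \<in> S \<Longrightarrow> 0 \<le> x k"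
    and row: "\<And>k. k \<in> S \<Longrightarrow> x k = 0 \<Longrightarrow> (\<Sum>l\<in>S. b k l * x l) \<le> 0"
  shows "(\<forall>k\<in>S. x k = 0) \<or> (\<forall>k\<in>S. 0 < x k)"
proof (cases "{k \<in> S. x k = 0} = {}")
  case True
  then show ?thesis using x by force
next
  case False
  have "b k l = 0" if "k \<in> {k \<in> S. x k = 0}" "l \<in> S - {k \<in> S. x k = 0}" for k l
  proof -
    \<comment> \<open>The row sum at a zero of \<open>x\<close> has nonnegative terms, so each term
      vanishes; where \<open>x l\<close> is nonzero this leaves \<open>b k l = 0\<close>.\<close>
    have "(\<Sum>l\<in>S. b k l * x l) = 0"
      using that row[of k] x nonneg by (intro antisym sum_nonneg) auto
    then have "\<forall>l\<in>S. b k l * x l = 0"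
      using that x nonneg finite by (subst (asm) sum_nonneg_eq_0_iff) auto
    then show ?thesis using that by auto
  qed
  then have "{k \<in> S. x k = 0} = S" using False by (intro irred) auto
  then show ?thesis by blast
qed

text \<open>If \<open>x\<close> had a positive entry, the least \<open>t\<close> with
  \<open>x \<le> t u\<close> would be positive. The gap \<open>y = t u - x\<close> is nonnegative
  and vanishes where the ratio \<open>x / u\<close> is maximal, so \<open>zero_or_positive\<close>
  makes it vanish everywhere. Then \<open>x = t u\<close>, against the strict inequality for
  \<open>u\<close>.\<close>

lemma strict_supersolution_imp_nonpos:
  assumes u: "\<And>k. k \<in> S \<Longrightarrow> 0 < u k"
    and super: "\<And>k. k \<in> S \<Longrightarrow> (\<Sum>l\<in>S. b k l * u l) \<le> \<alpha> * u k"
    and strict: "\<exists>k\<in>S. (\<Sum>l\<in>S. b k l * u l) < \<alpha> * u k"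
    and x: "\<And>k. k \<in> S \<Longrightarrow> (\<Sum>l\<in>S. b k l * x l) = \<alpha> * x k"
    and k: "k \<in> S"
  shows "x k \<le> 0"
proof (rule ccontr)
  assume pos: "\<not> x k \<le> 0"
  define t where "t = Max ((\<lambda>k. x k / u k) ` S)"
  have ne: "S \<noteq> {}" using k by auto
  have ge: "x j / u j \<le> t" if "j \<in> S" for j
    unfolding t_def using finite that by (intro Max_ge) auto
  have "0 < x k / u k" using pos u k by auto
  then have t: "0 < t" using ge[OF k] by linarith
  have "t \<in> (\<lambda>k. x k / u k) ` S" unfolding t_def using finite ne by (intro Max_in) auto
  then obtain m where m: "m \<in> S" "t = x m / u m" by auto
  define y where "y j = t * u j - x j" for j
  have row: "(\<Sum>l\<in>S. b j l * y l) = t * (\<Sum>l\<in>S. b j l * u l) - \<alpha> * x j" if "j \<in> S" for j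
    unfolding y_def x[OF that, symmetric]
    by (simp add: right_diff_distrib sum_subtractf sum_distrib_left mult.left_commute)
  have "(\<forall>k\<in>S. y k = 0) \<or> (\<forall>k\<in>S. 0 < y k)"
  proof (rule zero_or_positive)
    fix j assume j: "j \<in> S"
    show "0 \<le> y j" using ge[OF j] u[OF j] by (simp add: y_def field_simps)
    assume "y j = 0"
    then have "\<alpha> * x j = t * (\<alpha> * u j)" by (simp add: y_def)
    then show "(\<Sum>l\<in>S. b j l * y l) \<le> 0"
      using row[OF j] mult_left_mono[OF super[OF j], of t] t by linarith
  qed
  moreover have "y m = 0" using m u[OF m(1)] by (simp add: y_def)
  ultimately have y0: "\<And>j. j \<in> S \<Longrightarrow> y j = 0" using m by force
  obtain j where j: "j \<in> S" "(\<Sum>l\<in>S. b j l * u l) < \<alpha> * u j" using strict by auto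
  have "(\<Sum>l\<in>S. b j l * y l) = 0" using y0 by (intro sum.neutral) auto
  then have "t * (\<Sum>l\<in>S. b j l * u l) = \<alpha> * x j" using row[OF j(1)] by simp
  also have "\<dots> = t * (\<alpha> * u j)" using y0[OF j(1)] by (simp add: y_def)
  finally show False using j(2) t by simp
qed

text \<open>The sign bound applies to \<open>x\<close> and to \<open>- x\<close>.\<close>

lemma strict_supersolution_imp_regular:
  assumes u: "\<And>k. k \<in> S \<Longrightarrow> 0 < u k"
    and super: "\<And>k. k \<in> S \<Longrightarrow> (\<Sum>l\<in>S. b k l * u l) \<le> \<alpha> * u k"
    and strict: "\<exists>k\<in>S. (\<Sum>l\<in>S. b k l * u l) < \<alpha> * u k"
    and x: "\<And>k. k \<in> S \<Longrightarrow> (\<Sum>l\<in>S. b k l * x l) = \<alpha> * x k"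
    and k: "k \<in> S"
  shows "x k = 0"
proof (rule antisym)
  show "x k \<le> 0" by (rule strict_supersolution_imp_nonpos[OF u super strict x k])
  have "- x k \<le> 0"
    by (rule strict_supersolution_imp_nonpos[OF u super strict _ k]) (simp_all add: sum_negf x)
  then show "0 \<le> x k" by simp
qed

end

text \<open>The assumption \<open>growth\<close> says that \<open>\<rho>(b) \<le> \<alpha>\<close>. In this form it passes to
  diagonal blocks without further argument.\<close>

locale irreducible_nonneg_bounded = irreducible_nonneg +
  fixes \<alpha> :: real
  assumes alpha: "0 \<le> \<alpha>"
    and growth: "\<And>c x. \<alpha> < c \<Longrightarrow> (\<And>k. k \<in> S \<Longrightarrow> 0 \<le> x k) \<Longrightarrow>
      (\<And>k. k \<in> S \<Longrightarrow> c * x k \<le> (\<Sum>l\<in>S. b k l * x l)) \<Longrightarrow> (\<forall>k\<in>S. x k = 0)"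
begin

text \<open>On a finite nonempty \<open>S\<close> strictness leaves a uniform slack, so
  \<open>q\<close> still satisfies the inequality with \<open>\<alpha>\<close> raised to
  \<open>\<alpha> + d / h\<close>. Then \<open>growth\<close> gives \<open>q = 0\<close>, for which
  the strict inequality reads \<open>0 < 0\<close>.\<close>

lemma strict_subsolution_imp_empty:
  assumes q: "\<And>k. k \<in> S \<Longrightarrow> 0 \<le> q k"
    and sub: "\<And>k. k \<in> S \<Longrightarrow> \<alpha> * q k < (\<Sum>l\<in>S. b k l * q l)"
  shows "S = {}"
proof (rule ccontr)
  assume ne: "S \<noteq> {}"
  define d where "d = Min ((\<lambda>k. (\<Sum>l\<in>S. b k l * q l) - \<alpha> * q k) ` S)"
  \<comment> \<open>The summand 1 keeps \<open>h\<close> positive even if \<open>q\<close> vanishes,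
    so that \<open>d / h\<close> is a genuine increase of \<open>\<alpha>\<close>.\<close>
  define h where "h = Max (q ` S) + 1"
  have h: "q k \<le> h" if "k \<in> S" for k
    using Max_ge[of "q ` S" "q k"] finite that unfolding h_def by (simp add: add_increasing2)
  have "h \<ge> 1"
  proof -
    obtain k where "k \<in> S" using ne by auto
    then have "q k \<le> Max (q ` S)" using finite by auto
    then show ?thesis using q[OF \<open>k \<in> S\<close>] unfolding h_def by linarith
  qed
  have d: "d \<le> (\<Sum>l\<in>S. b k l * q l) - \<alpha> * q k" if "k \<in> S" for k
    unfolding d_def using finite that by (intro Min_le) auto
  have "d > 0" unfolding d_def using finite ne sub by (subst Min_gr_iff) auto
  have "\<forall>k\<in>S. q k = 0"
  proof (rule growth[of "\<alpha> + d / h"])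
    show "\<alpha> < \<alpha> + d / h" using \<open>d > 0\<close> \<open>h \<ge> 1\<close> by simp
    fix k assume k: "k \<in> S"
    have "d / h * q k \<le> d / h * h"
      using h[OF k] \<open>d > 0\<close> \<open>h \<ge> 1\<close> by (intro mult_left_mono) auto
    also have "\<dots> = d" using \<open>h \<ge> 1\<close> by simp
    finally show "(\<alpha> + d / h) * q k \<le> (\<Sum>l\<in>S. b k l * q l)"
      using d[OF k] by (simp add: distrib_right)
  qed (rule q)
  then have "(\<Sum>l\<in>S. b k l * q l) = 0" for k by simp
  then show False using sub ne \<open>\<forall>k\<in>S. q k = 0\<close> by force
qed

text \<open>Replacing \<open>q\<close> by \<open>q + b q\<close> turns the residual \<open>r = b q - \<alpha> q\<close> into \<open>r + b r\<close>, which has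
  fewer zeros. Once there are none left, the inequality is strict.\<close>

lemma subsolution_imp_solution:
  assumes "\<And>k. k \<in> S \<Longrightarrow> 0 \<le> q k"
    and "\<And>k. k \<in> S \<Longrightarrow> \<alpha> * q k \<le> (\<Sum>l\<in>S. b k l * q l)"
  shows "\<forall>k\<in>S. \<alpha> * q k = (\<Sum>l\<in>S. b k l * q l)"
  using assms
proof (induction "card {k \<in> S. (\<Sum>l\<in>S. b k l * q l) - \<alpha> * q k = 0}" arbitrary: q rule: less_induct)
  case less
  define r where "r k = (\<Sum>l\<in>S. b k l * q l) - \<alpha> * q k" for k
  define q' where "q' k = q k + (\<Sum>l\<in>S. b k l * q l)" for k
  have r: "0 \<le> r k" if "k \<in> S" for k using less.prems(2)[OF that] by (simp add: r_def)
  have br: "0 \<le> (\<Sum>l\<in>S. b k l * r l)" if "k \<in> S" for k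
    using that r nonneg by (intro sum_nonneg) auto
  have r': "(\<Sum>l\<in>S. b k l * q' l) - \<alpha> * q' k = r k + (\<Sum>l\<in>S. b k l * r l)" if "k \<in> S" for k
    by (simp add: r_def q'_def distrib_left right_diff_distrib sum.distrib sum_subtractf
        sum_distrib_left mult.left_commute)
  show ?case
  proof (rule ccontr)
    assume not: "\<not> ?thesis"
    then obtain k0 where k0: "k0 \<in> S" "r k0 \<noteq> 0" unfolding r_def by auto
    have "\<exists>k\<in>S. r k = 0"
    proof (rule ccontr)
      assume "\<not> (\<exists>k\<in>S. r k = 0)"
      then have "\<alpha> * q k < (\<Sum>l\<in>S. b k l * q l)" if "k \<in> S" for k
        using r[OF that] that unfolding r_def by fastforce
      then have "S = {}" using less.prems(1) by (intro strict_subsolution_imp_empty[of q])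
      then show False using k0 by auto
    qed
    \<comment> \<open>Otherwise \<open>zero_or_positive\<close> would apply to the residual
      \<open>r\<close> itself, which has both a zero entry and a nonzero one. At the index found
      here the residual \<open>r + b r\<close> of \<open>q'\<close> loses a zero.\<close>
    have ex: "\<exists>k\<in>S. r k = 0 \<and> (\<Sum>l\<in>S. b k l * r l) > 0"
    proof (rule ccontr)
      assume "\<not> ?thesis"
      then have "(\<forall>k\<in>S. r k = 0) \<or> (\<forall>k\<in>S. 0 < r k)"
        using r by (intro zero_or_positive) (auto simp: not_less)
      then show False using k0 \<open>\<exists>k\<in>S. r k = 0\<close> by auto
    qed
    have "{k \<in> S. (\<Sum>l\<in>S. b k l * q' l) - \<alpha> * q' k = 0} \<subseteq> {k \<in> S. r k = 0}"
    proof safe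
      fix k assume k: "k \<in> S" "(\<Sum>l\<in>S. b k l * q' l) - \<alpha> * q' k = 0"
      then show "r k = 0" using r'[OF k(1)] r[OF k(1)] br[OF k(1)] by linarith
    qed
    moreover obtain k1 where k1: "k1 \<in> S" "r k1 = 0" "(\<Sum>l\<in>S. b k1 l * r l) > 0" using ex by blast
    moreover have "(\<Sum>l\<in>S. b k1 l * q' l) - \<alpha> * q' k1 \<noteq> 0" using r'[OF k1(1)] k1 by linarith
    ultimately have "{k \<in> S. (\<Sum>l\<in>S. b k l * q' l) - \<alpha> * q' k = 0} \<subset> {k \<in> S. r k = 0}"
      by blast
    then have card: "card {k \<in> S. (\<Sum>l\<in>S. b k l * q' l) - \<alpha> * q' k = 0} < card {k \<in> S. r k = 0}"
      using finite by (intro psubset_card_mono) auto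
    have "\<forall>k\<in>S. \<alpha> * q' k = (\<Sum>l\<in>S. b k l * q' l)"
    proof (rule less.hyps[OF card[unfolded r_def]])
      fix k assume k: "k \<in> S"
      show "0 \<le> q' k" unfolding q'_def using k less.prems(1) nonneg by (intro add_nonneg_nonneg sum_nonneg) auto
      show "\<alpha> * q' k \<le> (\<Sum>l\<in>S. b k l * q' l)" using r'[OF k] r[OF k] br[OF k] by linarith
    qed
    \<comment> \<open>The new residual vanishes by induction, although it is the sum of the positive
      \<open>r k0\<close> and a nonnegative term.\<close>
    then have "r k0 + (\<Sum>l\<in>S. b k0 l * r l) = 0" using r'[OF k0(1)] k0(1) by simp
    then show False using r[OF k0(1)] br[OF k0(1)] k0(2) by linarith
  qed
qed

text \<open>By the triangle inequality \<open>\<bar>x\<bar>\<close> is a subsolution, hence a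
  solution by \<open>subsolution_imp_solution\<close>, and \<open>zero_or_positive\<close> excludes
  zero entries.\<close>

lemma singular_imp_positive_null_vector:
  assumes x: "\<And>k. k \<in> S \<Longrightarrow> (\<Sum>l\<in>S. b k l * x l) = \<alpha> * x k" and nz: "\<exists>k\<in>S. x k \<noteq> 0"
  shows "\<forall>k\<in>S. 0 < \<bar>x k\<bar> \<and> (\<Sum>l\<in>S. b k l * \<bar>x l\<bar>) = \<alpha> * \<bar>x k\<bar>"
proof -
  have "\<alpha> * \<bar>x k\<bar> \<le> (\<Sum>l\<in>S. b k l * \<bar>x l\<bar>)" if k: "k \<in> S" for k
  proof -
    have "\<alpha> * \<bar>x k\<bar> = \<bar>\<Sum>l\<in>S. b k l * x l\<bar>" using x[OF k] alpha by (simp add: abs_mult)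
    also have "\<dots> \<le> (\<Sum>l\<in>S. \<bar>b k l * x l\<bar>)" by (rule sum_abs)
    also have "\<dots> = (\<Sum>l\<in>S. b k l * \<bar>x l\<bar>)"
      using nonneg k by (intro sum.cong) (auto simp: abs_mult)
    finally show ?thesis .
  qed
  then have eq: "\<forall>k\<in>S. \<alpha> * \<bar>x k\<bar> = (\<Sum>l\<in>S. b k l * \<bar>x l\<bar>)"
    by (intro subsolution_imp_solution) auto
  then have "(\<forall>k\<in>S. \<bar>x k\<bar> = 0) \<or> (\<forall>k\<in>S. 0 < \<bar>x k\<bar>)"
    by (intro zero_or_positive) auto
  then show ?thesis using nz eq by auto
qed

text \<open>The negative part \<open>q\<close> of \<open>x\<close> is a subsolution, hence a null
  vector, hence zero by regularity. So \<open>x \<ge> 0\<close>, and \<open>zero_or_positive\<close>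
  leaves only \<open>x > 0\<close>, because \<open>x = 0\<close> would force
  \<open>w = 0\<close>.\<close>

lemma regular_solution_positive:
  assumes reg: "\<And>x. (\<And>k. k \<in> S \<Longrightarrow> (\<Sum>l\<in>S. b k l * x l) = \<alpha> * x k) \<Longrightarrow> \<forall>k\<in>S. x k = 0"
    and x: "\<And>k. k \<in> S \<Longrightarrow> \<alpha> * x k = (\<Sum>l\<in>S. b k l * x l) + w k"
    and w: "\<And>k. k \<in> S \<Longrightarrow> 0 \<le> w k" and nz: "\<exists>k\<in>S. w k \<noteq> 0"
  shows "\<forall>k\<in>S. 0 < x k"
proof -
  define q where "q k = max 0 (- x k)" for k
  have "\<alpha> * q k \<le> (\<Sum>l\<in>S. b k l * q l)" if k: "k \<in> S" for k
  proof (cases "x k \<ge> 0")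
    case True
    then have "q k = 0" by (simp add: q_def)
    moreover have "0 \<le> (\<Sum>l\<in>S. b k l * q l)"
      using k nonneg by (intro sum_nonneg) (auto simp: q_def)
    ultimately show ?thesis by simp
  next
    case False
    \<comment> \<open>At a negative entry the term \<open>w k \<ge> 0\<close> is dropped from the
      equation, and then \<open>- x \<le> q\<close> is used entrywise.\<close>
    then have "\<alpha> * q k = - (\<alpha> * x k)" by (simp add: q_def)
    also have "\<dots> \<le> (\<Sum>l\<in>S. b k l * - x l)" using x[OF k] w[OF k] by (simp add: sum_negf)
    also have "\<dots> \<le> (\<Sum>l\<in>S. b k l * q l)"
      using nonneg k by (intro sum_mono mult_left_mono) (auto simp: q_def)
    finally show ?thesis .
  qed
  then have "\<forall>k\<in>S. \<alpha> * q k = (\<Sum>l\<in>S. b k l * q l)"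
    by (intro subsolution_imp_solution) (auto simp: q_def)
  then have "\<forall>k\<in>S. q k = 0" by (intro reg) simp
  then have x0: "0 \<le> x k" if "k \<in> S" for k
    using max.cobounded2[of "- x k" 0] that unfolding q_def by fastforce
  have "(\<Sum>l\<in>S. b k l * x l) \<le> 0" if "k \<in> S" "x k = 0" for k
  proof -
    have "\<alpha> * x k = 0" using that(2) by simp
    then show ?thesis using x[OF that(1)] w[OF that(1)] by linarith
  qed
  then have "(\<forall>k\<in>S. x k = 0) \<or> (\<forall>k\<in>S. 0 < x k)" using x0 by (intro zero_or_positive)
  moreover have "\<not> (\<forall>k\<in>S. x k = 0)"
  proof
    assume "\<forall>k\<in>S. x k = 0"
    then have "w k = 0" if "k \<in> S" for k using x[OF that] that by simp
    then show False using nz by blast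
  qed
  ultimately show ?thesis by blast
qed

end

section \<open>Block triangular nonnegative matrices\<close>

text \<open>This is the Frobenius normal form of \<open>\<alpha> I - b\<close> in terms of index
  sets: \<open>S i\<close> holds the indices of block \<open>i\<close>. The spectral bound
  \<open>growth\<close> is assumed for the whole matrix only.\<close>

locale block_triangular_nonneg =
  fixes S :: "nat \<Rightarrow> 'a set" and m :: nat and b :: "'a \<Rightarrow> 'a \<Rightarrow> real" and \<alpha> :: real
  assumes finite: "\<And>i. i < m \<Longrightarrow> finite (S i)"
    and nonempty: "\<And>i. i < m \<Longrightarrow> S i \<noteq> {}"
    and disjoint: "\<And>i j. i < m \<Longrightarrow> j < m \<Longrightarrow> i \<noteq> j \<Longrightarrow> S i \<inter> S j = {}"
    and nonneg: "\<And>k l. k \<in> (\<Union>i<m. S i) \<Longrightarrow> l \<in> (\<Union>i<m. S i) \<Longrightarrow> 0 \<le> b k l"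
    and triangular: "\<And>i j k l. j < i \<Longrightarrow> i < m \<Longrightarrow> k \<in> S i \<Longrightarrow> l \<in> S j \<Longrightarrow> b k l = 0"
    and irred: "\<And>i Z. i < m \<Longrightarrow> Z \<subseteq> S i \<Longrightarrow> Z \<noteq> {} \<Longrightarrow>
      (\<And>k l. k \<in> Z \<Longrightarrow> l \<in> S i - Z \<Longrightarrow> b k l = 0) \<Longrightarrow> Z = S i"
    and alpha: "0 \<le> \<alpha>"
    and growth: "\<And>c x. \<alpha> < c \<Longrightarrow> (\<And>k. k \<in> (\<Union>i<m. S i) \<Longrightarrow> 0 \<le> x k) \<Longrightarrow>
      (\<And>k. k \<in> (\<Union>i<m. S i) \<Longrightarrow> c * x k \<le> (\<Sum>l\<in>(\<Union>i<m. S i). b k l * x l)) \<Longrightarrow>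
      (\<forall>k\<in>(\<Union>i<m. S i). x k = 0)"
begin

definition I :: "'a set" where "I = (\<Union>i<m. S i)"

text \<open>Nonsingularity of the diagonal block of \<open>\<alpha> I - b\<close>, expressed as
  triviality of its kernel.\<close>

definition regular :: "nat \<Rightarrow> bool" where
  "regular i \<longleftrightarrow> (\<forall>x. (\<forall>k\<in>S i. (\<Sum>l\<in>S i. b k l * x l) = \<alpha> * x k) \<longrightarrow> (\<forall>k\<in>S i. x k = 0))"

lemma finite_I: "Finite_Set.finite I"
  unfolding I_def using finite by auto

lemma S_subset_I: "i < m \<Longrightarrow> S i \<subseteq> I"
  unfolding I_def by auto

lemma nonneg_I: "k \<in> I \<Longrightarrow> l \<in> I \<Longrightarrow> 0 \<le> b k l"
  unfolding I_def by (rule nonneg)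

text \<open>For \<open>growth\<close>, a vector on the block is extended by zero. Inside the block
  the row sums do not change; outside it the left side is 0 and the right side is
  nonnegative.\<close>

lemma diagonal_block:
  assumes i: "i < m"
  shows "irreducible_nonneg_bounded (S i) b \<alpha>"
proof unfold_locales
  note sub = S_subset_I[OF i]
  show "Finite_Set.finite (S i)" by (rule finite[OF i])
  show "0 \<le> b k l" if "k \<in> S i" "l \<in> S i" for k l
    using that sub by (intro nonneg_I) auto
  show "Z = S i" if "Z \<subseteq> S i" "Z \<noteq> {}" "\<And>k l. k \<in> Z \<Longrightarrow> l \<in> S i - Z \<Longrightarrow> b k l = 0" for Z
    using irred[OF i that] by blast
  show "0 \<le> \<alpha>" by (rule alpha)
  fix c x
  assume c: "\<alpha> < c" and x: "\<And>k. k \<in> S i \<Longrightarrow> 0 \<le> x k"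
    and le: "\<And>k. k \<in> S i \<Longrightarrow> c * x k \<le> (\<Sum>l\<in>S i. b k l * x l)"
  define y where "y k = (if k \<in> S i then x k else 0)" for k
  have y: "0 \<le> y k" for k using x by (simp add: y_def)
  have "\<forall>k\<in>I. y k = 0"
  proof (rule growth[OF c, folded I_def])
    fix k assume k: "k \<in> I"
    have sum: "(\<Sum>l\<in>I. b k l * y l) = (\<Sum>l\<in>S i. b k l * x l)"
      using sub finite_I by (intro sum.mono_neutral_cong_right) (auto simp: y_def)
    show "c * y k \<le> (\<Sum>l\<in>I. b k l * y l)"
    proof (cases "k \<in> S i")
      case True
      then show ?thesis using le sum by (simp add: y_def)
    next
      case False
      have "0 \<le> (\<Sum>l\<in>I. b k l * y l)" using k nonneg_I y by (intro sum_nonneg) auto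
      then show ?thesis using False by (simp add: y_def)
    qed
  qed (rule y)
  then show "\<forall>k\<in>S i. x k = 0" using sub unfolding y_def by (metis subsetD)
qed

lemma row_split:
  assumes "i < m"
  shows "(\<Sum>l\<in>I. b k l * u l) = (\<Sum>l\<in>S i. b k l * u l) + (\<Sum>l\<in>I - S i. b k l * u l)"
  using sum.subset_diff[OF S_subset_I[OF assms] finite_I] by (simp add: add.commute)

text \<open>On block \<open>i\<close> the vector \<open>u\<close> is a supersolution whose defect is
  the sum over the other blocks. A nonzero defect in some row makes the block regular; a defect that
  vanishes in all rows makes \<open>u\<close> a null vector of the block.\<close>

lemma
  assumes m: "0 < m" and u: "\<And>k. k \<in> I \<Longrightarrow> 0 < u k"
    and eq: "\<And>k. k \<in> I \<Longrightarrow> (\<Sum>l\<in>I. b k l * u l) = \<alpha> * u k"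
  shows positive_null_vector_imp_ex_singular: "\<exists>i<m. \<not> regular i"
    and positive_null_vector_imp_singular_row:
      "\<lbrakk>i < m; \<not> regular i; j < m; j \<noteq> i; k \<in> S i; l \<in> S j\<rbrakk> \<Longrightarrow> b k l = 0"
    and positive_null_vector_imp_regular_row:
      "\<lbrakk>i < m; regular i\<rbrakk> \<Longrightarrow> \<exists>j<m. j \<noteq> i \<and> (\<exists>k\<in>S i. \<exists>l\<in>S j. b k l \<noteq> 0)"
proof -
  show sing: "b k l = 0" if that: "i < m" "\<not> regular i" "j < m" "j \<noteq> i" "k \<in> S i" "l \<in> S j" for i j k l
  proof -
    interpret D: irreducible_nonneg_bounded "S i" b \<alpha> by (rule diagonal_block[OF that(1)])
    have sub: "S i \<subseteq> I" by (rule S_subset_I[OF that(1)])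
    have rest: "0 \<le> (\<Sum>l\<in>I - S i. b k l * u l)" if "k \<in> S i" for k
      using that sub nonneg_I u by (intro sum_nonneg mult_nonneg_nonneg less_imp_le[OF u]) auto
    have row: "(\<Sum>l\<in>S i. b k l * u l) = \<alpha> * u k - (\<Sum>l\<in>I - S i. b k l * u l)" if "k \<in> S i" for k
      using row_split[OF \<open>i < m\<close>, of k u] eq[of k] sub that by auto
    have "(\<Sum>l\<in>I - S i. b k l * u l) = 0"
    proof (rule ccontr)
      assume ne: "\<not> ?thesis"
      have "regular i"
        unfolding regular_def
      proof (intro allI impI ballI)
        fix x k' assume x: "\<forall>k\<in>S i. (\<Sum>l\<in>S i. b k l * x l) = \<alpha> * x k" and k': "k' \<in> S i"
        show "x k' = 0"
        proof (rule D.strict_supersolution_imp_regular[of u \<alpha>])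
          show "0 < u k" if "k \<in> S i" for k using that sub u by auto
          show "(\<Sum>l\<in>S i. b k l * u l) \<le> \<alpha> * u k" if "k \<in> S i" for k
            using row[OF that] rest[OF that] by linarith
          show "\<exists>k\<in>S i. (\<Sum>l\<in>S i. b k l * u l) < \<alpha> * u k"
            using row[OF \<open>k \<in> S i\<close>] rest[OF \<open>k \<in> S i\<close>] ne \<open>k \<in> S i\<close>
            by (intro bexI[of _ k]) auto
        qed (use x k' in auto)
      qed
      then show False using that by simp
    qed
    \<comment> \<open>A vanishing sum of nonnegative terms vanishes termwise, and
      \<open>u l > 0\<close> then gives \<open>b k l = 0\<close>.\<close>
    then have "\<forall>l\<in>I - S i. b k l * u l = 0"
      using that sub nonneg_I finite_I u
      by (subst (asm) sum_nonneg_eq_0_iff) (auto intro!: mult_nonneg_nonneg less_imp_le[OF u])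
    moreover have "l \<in> I - S i"
      using that disjoint[of i j] S_subset_I[of j] by auto
    ultimately show ?thesis using u[of l] by force
  qed
  show reg: "\<exists>j<m. j \<noteq> i \<and> (\<exists>k\<in>S i. \<exists>l\<in>S j. b k l \<noteq> 0)" if that: "i < m" "regular i" for i
  proof (rule ccontr)
    assume not: "\<not> ?thesis"
    have sub: "S i \<subseteq> I" by (rule S_subset_I[OF that(1)])
    have "(\<Sum>l\<in>S i. b k l * u l) = \<alpha> * u k" if k: "k \<in> S i" for k
    proof -
      have "(\<Sum>l\<in>I - S i. b k l * u l) = 0"
        using not k unfolding I_def by (intro sum.neutral) auto
      then show ?thesis using row_split[OF \<open>i < m\<close>, of k u] eq[of k] sub k by auto
    qed
    then have "\<forall>k\<in>S i. u k = 0" using that(2) unfolding regular_def by blast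
    then show False using nonempty[OF that(1)] u sub by force
  qed
  show "\<exists>i<m. \<not> regular i"
  proof (rule ccontr)
    assume "\<not> ?thesis"
    \<comment> \<open>The last block has nothing to its right, so a nonzero entry in another block
      of its rows would lie below the diagonal.\<close>
    then have "regular (m - 1)" using m by simp
    then obtain j k l where jkl: "j < m" "j \<noteq> m - 1" "k \<in> S (m - 1)" "l \<in> S j" "b k l \<noteq> 0"
      using reg[of "m - 1"] m by auto
    then have "b k l = 0" by (intro triangular[of j "m - 1"]) auto
    then show False using jkl by simp
  qed
qed

text \<open>Back substitution, with \<open>t\<close> decreasing from \<open>m\<close>: rows of block
  \<open>t\<close> involve only the blocks from \<open>t\<close> on, and a change of
  \<open>u\<close> on block \<open>t\<close> leaves the rows of later blocks intact.\<close>

lemma ex_positive_null_vector_from: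
  assumes sing: "\<And>i j k l. \<lbrakk>i < m; \<not> regular i; j < m; j \<noteq> i; k \<in> S i; l \<in> S j\<rbrakk> \<Longrightarrow> b k l = 0"
    and reg: "\<And>i. \<lbrakk>i < m; regular i\<rbrakk> \<Longrightarrow> \<exists>j<m. j \<noteq> i \<and> (\<exists>k\<in>S i. \<exists>l\<in>S j. b k l \<noteq> 0)"
    and solve: "\<And>i w. \<lbrakk>i < m; regular i\<rbrakk> \<Longrightarrow> \<exists>x. \<forall>k\<in>S i. \<alpha> * x k = (\<Sum>l\<in>S i. b k l * x l) + w k"
    and t: "t \<le> m"
  shows "\<exists>u. \<forall>i\<in>{t..<m}. \<forall>k\<in>S i. 0 < u k \<and> (\<Sum>l\<in>I. b k l * u l) = \<alpha> * u k"
  using t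
proof (induction t rule: inc_induct)
  case base
  then show ?case by simp
next
  case (step t)
  then obtain u where u: "\<And>i k. \<lbrakk>t < i; i < m; k \<in> S i\<rbrakk> \<Longrightarrow> 0 < u k"
    and eq: "\<And>i k. \<lbrakk>t < i; i < m; k \<in> S i\<rbrakk> \<Longrightarrow> (\<Sum>l\<in>I. b k l * u l) = \<alpha> * u k"
    by (metis Suc_leI atLeastLessThan_iff)
  have t: "t < m" using step by simp
  have sub: "S t \<subseteq> I" by (rule S_subset_I[OF t])
  interpret D: irreducible_nonneg_bounded "S t" b \<alpha> by (rule diagonal_block[OF t])
  \<comment> \<open>The right-hand side that the other blocks contribute to block \<open>t\<close>.
    The values of \<open>u\<close> on earlier blocks are arbitrary, but they meet only zero entries
    of \<open>b\<close>.\<close>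
  define w where "w k = (\<Sum>l\<in>I - S t. b k l * u l)" for k
  have term_nonneg: "0 \<le> b k l * u l" if k: "k \<in> S t" and l: "l \<in> I - S t" for k l
  proof -
    obtain j where j: "j < m" "l \<in> S j" "j \<noteq> t" using l unfolding I_def by auto
    show ?thesis
    proof (cases "j < t")
      case True
      then show ?thesis using triangular[OF True t k j(2)] by simp
    next
      case False
      then have "0 < u l" using j by (intro u[of j]) auto
      then show ?thesis using k l sub nonneg_I[of k l] by auto
    qed
  qed
  have "\<exists>x. \<forall>k\<in>S t. 0 < x k \<and> \<alpha> * x k = (\<Sum>l\<in>S t. b k l * x l) + w k"
  proof (cases "regular t")
    case False
    then obtain x where x: "\<And>k. k \<in> S t \<Longrightarrow> (\<Sum>l\<in>S t. b k l * x l) = \<alpha> * x k" "\<exists>k\<in>S t. x k \<noteq> 0"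
      unfolding regular_def by auto
    have "w k = 0" if k: "k \<in> S t" for k
      unfolding w_def
    proof (intro sum.neutral ballI)
      fix l assume "l \<in> I - S t"
      then obtain j where "j < m" "l \<in> S j" "j \<noteq> t" unfolding I_def by auto
      then show "b k l * u l = 0" using sing[OF t False _ _ k] by simp
    qed
    then show ?thesis
      using D.singular_imp_positive_null_vector[OF x]
      by (intro exI[of _ "\<lambda>k. \<bar>x k\<bar>"]) auto
  next
    case True
    then obtain x where x: "\<And>k. k \<in> S t \<Longrightarrow> \<alpha> * x k = (\<Sum>l\<in>S t. b k l * x l) + w k"
      using solve[OF t True, of w] by auto
    have "\<forall>k\<in>S t. 0 < x k"
    proof (rule D.regular_solution_positive[OF _ x])
      show "\<forall>k\<in>S t. y k = 0" if "\<And>k. k \<in> S t \<Longrightarrow> (\<Sum>l\<in>S t. b k l * y l) = \<alpha> * y k" for y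
        using True that unfolding regular_def by blast
      show "0 \<le> w k" if "k \<in> S t" for k
        unfolding w_def using term_nonneg that by (intro sum_nonneg) auto
      obtain j k l where jkl: "j < m" "j \<noteq> t" "k \<in> S t" "l \<in> S j" "b k l \<noteq> 0"
        using reg[OF t True] by auto
      \<comment> \<open>By triangularity the nonzero entry lies in a later block, where
        \<open>u\<close> is already positive; this makes \<open>w k\<close> nonzero.\<close>
      have "t < j" using triangular[of j t k l] jkl t by (meson nat_neq_iff)
      then have "b k l * u l \<noteq> 0" using u[of j l] jkl by auto
      moreover have l: "l \<in> I - S t" using jkl disjoint[of j t] t S_subset_I[of j] by auto
      ultimately have "w k \<noteq> 0"
        unfolding w_def using term_nonneg[OF jkl(3)] finite_I by (subst sum_nonneg_eq_0_iff) auto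
      then show "\<exists>k\<in>S t. w k \<noteq> 0" using jkl by auto
    qed
    then show ?thesis using x by auto
  qed
  then obtain x where x: "\<And>k. k \<in> S t \<Longrightarrow> 0 < x k"
    "\<And>k. k \<in> S t \<Longrightarrow> \<alpha> * x k = (\<Sum>l\<in>S t. b k l * x l) + w k" by auto
  define v where "v k = (if k \<in> S t then x k else u k)" for k
  have row: "(\<Sum>l\<in>I. b k l * v l) = (\<Sum>l\<in>S t. b k l * x l) + w k" for k
    unfolding row_split[OF t] w_def by (auto simp: v_def intro!: arg_cong2[of _ _ _ _ "(+)"] sum.cong)
  have "0 < v k \<and> (\<Sum>l\<in>I. b k l * v l) = \<alpha> * v k" if i: "i \<in> {t..<m}" and k: "k \<in> S i" for i k
  proof (cases "i = t")
    case True
    then show ?thesis unfolding row using x k by (simp add: v_def)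
  next
    case False
    then have i': "t < i" "i < m" using i by auto
    then have "k \<notin> S t" using disjoint[of i t] t k by auto
    have "(\<Sum>l\<in>I. b k l * v l) = (\<Sum>l\<in>I. b k l * u l)"
    proof (rule sum.cong)
      fix l
      show "b k l * v l = b k l * u l" using triangular[OF i' k, of l] by (simp add: v_def)
    qed simp
    then show ?thesis using u[OF i' k] eq[OF i' k] \<open>k \<notin> S t\<close> by (simp add: v_def)
  qed
  then show ?case by blast
qed

text \<open>The assumption \<open>solve\<close> says that a regular block can be solved for every
  right-hand side; for matrix blocks it comes from the inverse.\<close>

theorem ex_positive_null_vector_iff:
  assumes m: "0 < m"
    and solve: "\<And>i w. \<lbrakk>i < m; regular i\<rbrakk> \<Longrightarrow> \<exists>x. \<forall>k\<in>S i. \<alpha> * x k = (\<Sum>l\<in>S i. b k l * x l) + w k"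
  shows "(\<exists>u. \<forall>k\<in>I. 0 < u k \<and> (\<Sum>l\<in>I. b k l * u l) = \<alpha> * u k) \<longleftrightarrow>
    (\<exists>i<m. \<not> regular i) \<and>
    (\<forall>i<m. \<not> regular i \<longrightarrow> (\<forall>j<m. j \<noteq> i \<longrightarrow> (\<forall>k\<in>S i. \<forall>l\<in>S j. b k l = 0))) \<and>
    (\<forall>i<m. regular i \<longrightarrow> (\<exists>j<m. j \<noteq> i \<and> \<not> (\<forall>k\<in>S i. \<forall>l\<in>S j. b k l = 0)))"
    (is "?L \<longleftrightarrow> ?R1 \<and> ?R2 \<and> ?R3")
proof
  assume ?L
  then obtain u where u: "\<And>k. k \<in> I \<Longrightarrow> 0 < u k" "\<And>k. k \<in> I \<Longrightarrow> (\<Sum>l\<in>I. b k l * u l) = \<alpha> * u k"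
    by auto
  have ?R1 by (rule positive_null_vector_imp_ex_singular[OF m u])
  moreover have ?R2 using positive_null_vector_imp_singular_row[OF m u] by blast
  moreover have ?R3 using positive_null_vector_imp_regular_row[OF m u] by blast
  ultimately show "?R1 \<and> ?R2 \<and> ?R3" by blast
next
  assume R: "?R1 \<and> ?R2 \<and> ?R3"
  have "\<exists>u. \<forall>i\<in>{0..<m}. \<forall>k\<in>S i. 0 < u k \<and> (\<Sum>l\<in>I. b k l * u l) = \<alpha> * u k"
    by (rule ex_positive_null_vector_from[OF _ _ solve]) (use R in blast)+
  then show ?L unfolding I_def by (metis UN_E atLeastLessThan_iff lessThan_iff zero_le)
qed

end

section \<open>Blocks of a matrix\<close>

text \<open>For the converse direction the determinant is the link: a trivial kernel makes it
  nonzero, so \<open>C\<close> is a unit of the matrix ring.\<close>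

lemma invertible_mat_iff_kernel:
  fixes C :: "'a :: field mat"
  assumes C: "C \<in> carrier_mat m m"
  shows "invertible_mat C \<longleftrightarrow> (\<forall>v\<in>carrier_vec m. C *\<^sub>v v = 0\<^sub>v m \<longrightarrow> v = 0\<^sub>v m)"
proof
  assume "invertible_mat C"
  then obtain B where B: "C * B = 1\<^sub>m m" "B * C = 1\<^sub>m (dim_row B)"
    using C unfolding invertible_mat_def inverts_mat_def by auto
  \<comment> \<open>\<open>inverts_mat\<close> does not prescribe the size of \<open>B\<close>; it
    is read off from the two products.\<close>
  have "dim_row B = m" using arg_cong[OF B(2), of dim_col] C by simp
  moreover have "dim_col B = m" using arg_cong[OF B(1), of dim_col] by simp
  ultimately have Bc: "B \<in> carrier_mat m m" by auto
  show "\<forall>v\<in>carrier_vec m. C *\<^sub>v v = 0\<^sub>v m \<longrightarrow> v = 0\<^sub>v m"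
  proof (intro ballI impI)
    fix v assume v: "v \<in> carrier_vec m" "C *\<^sub>v v = 0\<^sub>v m"
    have "v = (B * C) *\<^sub>v v" using B(2) Bc v by simp
    also have "\<dots> = B *\<^sub>v (C *\<^sub>v v)" by (rule assoc_mult_mat_vec[OF Bc C v(1)])
    also have "\<dots> = 0\<^sub>v m" unfolding v(2) using Bc by (intro eq_vecI) auto
    finally show "v = 0\<^sub>v m" .
  qed
next
  assume "\<forall>v\<in>carrier_vec m. C *\<^sub>v v = 0\<^sub>v m \<longrightarrow> v = 0\<^sub>v m"
  then have "det C \<noteq> 0" using det_0_iff_vec_prod_zero_field[OF C] by auto
  then have "C \<in> Units (ring_mat TYPE('a) m ())" by (rule det_non_zero_imp_unit[OF C])
  then obtain B where "B \<in> carrier_mat m m" "B * C = 1\<^sub>m m" "C * B = 1\<^sub>m m"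
    unfolding Units_def ring_mat_simps by auto
  then show "invertible_mat C" using C unfolding invertible_mat_def inverts_mat_def by auto
qed

lemma invertible_mat_imp_solvable:
  fixes C :: "'a :: comm_ring_1 mat"
  assumes C: "C \<in> carrier_mat m m" and inv: "invertible_mat C" and w: "w \<in> carrier_vec m"
  shows "\<exists>v\<in>carrier_vec m. C *\<^sub>v v = w"
proof -
  obtain B where B: "C * B = 1\<^sub>m m" "B * C = 1\<^sub>m (dim_row B)"
    using C inv unfolding invertible_mat_def inverts_mat_def by auto
  have "dim_row B = m" using arg_cong[OF B(2), of dim_col] C by simp
  moreover have "dim_col B = m" using arg_cong[OF B(1), of dim_col] by simp
  ultimately have Bc: "B \<in> carrier_mat m m" by auto
  have "C *\<^sub>v (B *\<^sub>v w) = w"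
    using assoc_mult_mat_vec[OF C Bc w] B(1) w by simp
  then show ?thesis using Bc w by (intro bexI[of _ "B *\<^sub>v w"]) auto
qed

section \<open>Index sets of consecutive blocks and the entries they select\<close>

lemma pick_atLeastLessThan: "i < t - s \<Longrightarrow> pick {s..<t} i = s + i"
proof -
  assume i: "i < t - s"
  have "{a \<in> {s..<t}. a < s + i} = {s..<s + i}" using i by auto
  then show ?thesis using pick_card_in_set[of "s + i" "{s..<t}"] i by simp
qed

lemma sum_list_take_mono: "i \<le> j \<Longrightarrow> sum_list (take i ns) \<le> sum_list (take j (ns :: nat list))"
proof -
  assume "i \<le> j"
  then have "take j ns = take i ns @ take (j - i) (drop i ns)" by (metis le_add_diff_inverse take_add)
  then show ?thesis by simp
qed

lemma block_indices_eq:
  "i < length ns \<Longrightarrow> block_indices ns i = {sum_list (take i ns)..<sum_list (take i ns) + ns ! i}"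
  by (simp add: block_indices_def take_Suc_conv_app_nth)

lemma block_indices_subset: "block_indices ns i \<subseteq> {..<sum_list ns}"
  using sum_list_take_mono[of "Suc i" "max (Suc i) (length ns)" ns]
  by (auto simp: block_indices_def)

lemma block_indices_disjoint: "i \<noteq> j \<Longrightarrow> block_indices ns i \<inter> block_indices ns j = {}"
  using sum_list_take_mono[of "Suc i" j ns] sum_list_take_mono[of "Suc j" i ns]
  by (cases i j rule: linorder_cases) (auto simp: block_indices_def)

lemma UN_block_indices: "(\<Union>i<length ns. block_indices ns i) = {..<sum_list ns}"
proof -
  \<comment> \<open>This holds for every \<open>m\<close>: beyond the end of \<open>ns\<close>,
    \<open>take\<close> is constant and the further index sets are empty.\<close>
  have "(\<Union>i<m. block_indices ns i) = {..<sum_list (take m ns)}" for m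
  proof (induction m)
    case (Suc m)
    show ?case
      using sum_list_take_mono[of m "Suc m" ns] Suc
      by (auto simp: lessThan_Suc block_indices_def ivl_disj_un)
  qed simp
  then show ?thesis by simp
qed

context
  fixes ns :: "nat list" and A :: "'a mat"
  assumes A: "A \<in> carrier_mat (sum_list ns) (sum_list ns)"
begin

lemma block_carrier:
  assumes "i < length ns" "j < length ns"
  shows "block ns A i j \<in> carrier_mat (ns ! i) (ns ! j)"
proof -
  have "{k. k < sum_list ns \<and> k \<in> block_indices ns i} = block_indices ns i" for i
    using block_indices_subset[of ns i] by auto
  moreover have "card (block_indices ns i) = ns ! i" if "i < length ns" for i
    using that by (simp add: block_indices_eq)
  ultimately show ?thesis using A assms
    by (intro carrier_matI) (simp_all add: block_def dim_submatrix)
qed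

lemma block_index:
  assumes ij: "i < length ns" "j < length ns" and pq: "p < ns ! i" "q < ns ! j"
  shows "block ns A i j $$ (p, q) = A $$ (sum_list (take i ns) + p, sum_list (take j ns) + q)"
proof -
  have "block ns A i j $$ (p, q) = A $$ (pick (block_indices ns i) p, pick (block_indices ns j) q)"
    using block_carrier[OF ij] pq unfolding block_def
    by (intro submatrix_index) (auto simp: dim_submatrix)
  then show ?thesis using assms by (simp add: block_indices_eq pick_atLeastLessThan)
qed

end

lemma block_eq_zero_iff:
  fixes A :: "'a :: zero mat"
  assumes A: "A \<in> carrier_mat (sum_list ns) (sum_list ns)" and ij: "i < length ns" "j < length ns"
  shows "block ns A i j = 0\<^sub>m (ns ! i) (ns ! j) \<longleftrightarrow>
    (\<forall>k\<in>block_indices ns i. \<forall>l\<in>block_indices ns j. A $$ (k, l) = 0)"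
    (is "?L \<longleftrightarrow> ?R")
proof
  assume L: ?L
  show ?R
  proof (intro ballI)
    fix k l assume kl: "k \<in> block_indices ns i" "l \<in> block_indices ns j"
    define p q where "p = k - sum_list (take i ns)" and "q = l - sum_list (take j ns)"
    have "p < ns ! i" "q < ns ! j" "k = sum_list (take i ns) + p" "l = sum_list (take j ns) + q"
      using kl ij unfolding p_def q_def by (auto simp: block_indices_eq)
    then show "A $$ (k, l) = 0" using block_index[OF A ij, of p q] L by simp
  qed
next
  assume R: ?R
  show ?L
  proof (rule eq_matI)
    fix p q assume "p < dim_row (0\<^sub>m (ns ! i) (ns ! j) :: 'a mat)" "q < dim_col (0\<^sub>m (ns ! i) (ns ! j) :: 'a mat)"
    then show "block ns A i j $$ (p, q) = (0\<^sub>m (ns ! i) (ns ! j) :: 'a mat) $$ (p, q)"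
      using R ij by (simp add: block_index[OF A] block_indices_eq)
  qed (use block_carrier[OF A ij] in auto)
qed

text \<open>If \<open>Z\<close> were proper, a permutation listing its complement \<open>W\<close>
  first and \<open>Z\<close> last would produce a zero lower left block, with rows from
  \<open>Z\<close> and columns from \<open>W\<close>.\<close>

lemma irreducible_mat_closed_set:
  fixes C :: "'a :: zero mat"
  assumes C: "C \<in> carrier_mat m m" and irr: "irreducible_mat C"
    and Z: "Z \<subseteq> {..<m}" "Z \<noteq> {}"
    and zero: "\<And>k l. k \<in> Z \<Longrightarrow> l \<in> {..<m} - Z \<Longrightarrow> C $$ (k, l) = 0"
  shows "Z = {..<m}"
proof (rule ccontr)
  assume ne: "Z \<noteq> {..<m}"
  define W where "W = {..<m} - Z"
  have fin: "finite Z" "finite W" using Z finite_subset unfolding W_def by auto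
  define r where "r = card W"
  have r: "0 < r" using ne Z fin unfolding r_def W_def by (auto simp: card_gt_0_iff)
  have cZ: "card Z = m - r"
    using card_Diff_subset[OF fin(1), of "{..<m}"] card_mono[OF _ Z(1)] Z
    unfolding r_def W_def by auto
  have rm: "r < m" using cZ Z fin by (metis card_gt_0_iff zero_less_diff)
  obtain f where f: "bij_betw f {0..<r} W" using ex_bij_betw_nat_finite[OF fin(2)] r_def by auto
  obtain h where h: "bij_betw h {0..<m - r} Z" using ex_bij_betw_nat_finite[OF fin(1)] cZ by auto
  \<comment> \<open>The enumerations of \<open>W\<close> and \<open>Z\<close> are placed one after
    the other; indices from \<open>m\<close> on are fixed, as \<open>permutes\<close>
    demands.\<close>
  define p where "p i = (if i < r then f i else if i < m then h (i - r) else i)" for i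
  have "bij_betw p {0..<r} W" using f by (rule bij_betw_cong[THEN iffD1, rotated]) (simp add: p_def)
  moreover have "bij_betw p {r..<m} Z"
  proof -
    have "bij_betw (\<lambda>i. i - r) {r..<m} {0..<m - r}"
      by (rule bij_betw_byWitness[where f' = "\<lambda>i. i + r"]) auto
    then have "bij_betw (h \<circ> (\<lambda>i. i - r)) {r..<m} Z" using h by (rule bij_betw_trans)
    then show ?thesis by (rule bij_betw_cong[THEN iffD1, rotated]) (simp add: p_def)
  qed
  ultimately have "bij_betw p ({0..<r} \<union> {r..<m}) (W \<union> Z)"
    by (rule bij_betw_combine) (auto simp: W_def)
  moreover have "{0..<r} \<union> {r..<m} = {..<m}" "W \<union> Z = {..<m}" using rm Z unfolding W_def by auto
  ultimately have "p permutes {..<m}" using rm by (intro bij_imp_permutes) (auto simp: p_def)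
  define D where "D = permute_mat p C"
  have D: "D \<in> carrier_mat (sum_list [r, m - r]) (sum_list [r, m - r])"
    using C rm unfolding D_def permute_mat_def by auto
  have "block [r, m - r] D 1 0 = 0\<^sub>m (m - r) r"
  proof (rule eq_matI)
    fix i j assume "i < dim_row (0\<^sub>m (m - r) r :: 'a mat)" "j < dim_col (0\<^sub>m (m - r) r :: 'a mat)"
    then have ij: "i < m - r" "j < r" by auto
    have "block [r, m - r] D 1 0 $$ (i, j) = D $$ (r + i, j)"
      using block_index[OF D, of 1 0 i j] ij by simp
    also have "\<dots> = C $$ (h i, f j)"
    proof -
      have "r + i < m" "j < m" using ij rm by auto
      then show ?thesis using C ij unfolding D_def permute_mat_def by (simp add: p_def)
    qed
    also have "\<dots> = 0"
      using bij_betwE[OF f] bij_betwE[OF h] ij by (intro zero) (auto simp: W_def)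
    finally show "block [r, m - r] D 1 0 $$ (i, j) = (0\<^sub>m (m - r) r :: 'a mat) $$ (i, j)"
      using ij by simp
  qed (use block_carrier[OF D, of 1 0] in auto)
  then have "block_upper_triangular [r, m - r] D"
    unfolding block_upper_triangular_def using D r rm by (auto simp: less_Suc_eq)
  moreover have "2 \<le> length [r, m - r]" by simp
  ultimately show False
    using irr C \<open>p permutes {..<m}\<close> unfolding irreducible_mat_def D_def by auto
qed

section \<open>Diagonal blocks as linear systems in global indices\<close>

context
  fixes ns :: "nat list" and A :: "'a :: field mat" and i :: nat
  assumes A: "A \<in> carrier_mat (sum_list ns) (sum_list ns)" and i: "i < length ns"
begin

text \<open>Shifting by the block offset turns local matrix coordinates into the global index sums
  of the block triangular setting.\<close>

lemma diagonal_block_mult_vec: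
  assumes "k \<in> block_indices ns i"
  shows "(block ns A i i *\<^sub>v vec (ns ! i) (\<lambda>q. x (sum_list (take i ns) + q))) $ (k - sum_list (take i ns)) =
    (\<Sum>l\<in>block_indices ns i. A $$ (k, l) * x l)"
proof -
  define s where "s = sum_list (take i ns)"
  have k: "k = s + (k - s)" "k - s < ns ! i"
    using assms i by (auto simp: block_indices_eq s_def)
  have "(\<Sum>l\<in>block_indices ns i. A $$ (k, l) * x l) = (\<Sum>q<ns ! i. A $$ (k, s + q) * x (s + q))"
    using i sum.shift_bounds_nat_ivl[of "\<lambda>l. A $$ (k, l) * x l" 0 s "ns ! i"]
    by (simp add: block_indices_eq s_def lessThan_atLeast0 add.commute)
  then show ?thesis
    using block_carrier[OF A i i] k block_index[OF A i i k(2)]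
    by (simp add: scalar_prod_def lessThan_atLeast0 flip: s_def)
qed

lemma diagonal_block_mult_vec_eq_iff:
  "block ns A i i *\<^sub>v vec (ns ! i) (\<lambda>q. x (sum_list (take i ns) + q)) =
      vec (ns ! i) (\<lambda>q. w (sum_list (take i ns) + q)) \<longleftrightarrow>
    (\<forall>k\<in>block_indices ns i. (\<Sum>l\<in>block_indices ns i. A $$ (k, l) * x l) = w k)"
  (is "?u = ?v \<longleftrightarrow> ?R")
proof -
  have dim: "dim_vec ?u = ns ! i" using block_carrier[OF A i i] by simp
  have "?u = ?v \<longleftrightarrow> (\<forall>q<ns ! i. ?u $ q = ?v $ q)" unfolding vec_eq_iff using dim by simp
  also have "\<dots> \<longleftrightarrow> (\<forall>k\<in>block_indices ns i. ?u $ (k - sum_list (take i ns)) = w k)"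
  proof safe
    fix k assume R: "\<forall>q<ns ! i. ?u $ q = ?v $ q" and k: "k \<in> block_indices ns i"
    then have "k - sum_list (take i ns) < ns ! i" "sum_list (take i ns) + (k - sum_list (take i ns)) = k"
      using i by (auto simp: block_indices_eq)
    then show "?u $ (k - sum_list (take i ns)) = w k" using R by (metis index_vec)
  next
    fix q assume R: "\<forall>k\<in>block_indices ns i. ?u $ (k - sum_list (take i ns)) = w k" and q: "q < ns ! i"
    then have "sum_list (take i ns) + q \<in> block_indices ns i" using i by (auto simp: block_indices_eq)
    then show "?u $ q = ?v $ q" using R q by (metis add_diff_cancel_left' index_vec)
  qed
  finally show ?thesis by (simp add: diagonal_block_mult_vec)
qed

lemma vec_of_block_indices:
  "v \<in> carrier_vec (ns ! i) \<Longrightarrow> \<exists>x. v = vec (ns ! i) (\<lambda>q. x (sum_list (take i ns) + q))"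
  by (intro exI[of _ "\<lambda>k. v $ (k - sum_list (take i ns))"]) auto

text \<open>With \<open>A = \<alpha> I - B\<close> the right-hand side becomes
  \<open>regular i\<close>.\<close>

lemma invertible_diagonal_block_iff:
  "invertible_mat (block ns A i i) \<longleftrightarrow>
    (\<forall>x. (\<forall>k\<in>block_indices ns i. (\<Sum>l\<in>block_indices ns i. A $$ (k, l) * x l) = 0) \<longrightarrow>
      (\<forall>k\<in>block_indices ns i. x k = 0))"
proof -
  let ?v = "\<lambda>x. vec (ns ! i) (\<lambda>q. x (sum_list (take i ns) + q)) :: 'a vec"
  have zero: "0\<^sub>v (ns ! i) = ?v (\<lambda>_. 0)" by auto
  have v0: "?v x = 0\<^sub>v (ns ! i) \<longleftrightarrow> (\<forall>k\<in>block_indices ns i. x k = 0)" for x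
  proof
    assume L: "?v x = 0\<^sub>v (ns ! i)"
    show "\<forall>k\<in>block_indices ns i. x k = 0"
    proof
      fix k assume k: "k \<in> block_indices ns i"
      then have "k - sum_list (take i ns) < ns ! i" "sum_list (take i ns) + (k - sum_list (take i ns)) = k"
        using i by (auto simp: block_indices_eq)
      then show "x k = 0" using arg_cong[OF L, of "\<lambda>v. v $ (k - sum_list (take i ns))"] by simp
    qed
  next
    assume "\<forall>k\<in>block_indices ns i. x k = 0"
    then show "?v x = 0\<^sub>v (ns ! i)" using i by (intro eq_vecI) (auto simp: block_indices_eq)
  qed
  have "invertible_mat (block ns A i i) \<longleftrightarrow>
      (\<forall>v\<in>carrier_vec (ns ! i). block ns A i i *\<^sub>v v = 0\<^sub>v (ns ! i) \<longrightarrow> v = 0\<^sub>v (ns ! i))"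
    by (rule invertible_mat_iff_kernel[OF block_carrier[OF A i i]])
  also have "\<dots> \<longleftrightarrow> (\<forall>x. block ns A i i *\<^sub>v ?v x = 0\<^sub>v (ns ! i) \<longrightarrow> ?v x = 0\<^sub>v (ns ! i))"
    using vec_of_block_indices by (metis vec_carrier)
  finally show ?thesis unfolding v0 unfolding zero diagonal_block_mult_vec_eq_iff[of _ "\<lambda>_. 0"] .
qed

lemma invertible_diagonal_block_imp_solvable:
  assumes "invertible_mat (block ns A i i)"
  shows "\<exists>x. \<forall>k\<in>block_indices ns i. (\<Sum>l\<in>block_indices ns i. A $$ (k, l) * x l) = w k"
proof -
  obtain v where "v \<in> carrier_vec (ns ! i)"
    "block ns A i i *\<^sub>v v = vec (ns ! i) (\<lambda>q. w (sum_list (take i ns) + q))"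
    using invertible_mat_imp_solvable[OF block_carrier[OF A i i] assms, of "vec (ns ! i) (\<lambda>q. w (sum_list (take i ns) + q))"]
    by auto
  moreover obtain x where "v = vec (ns ! i) (\<lambda>q. x (sum_list (take i ns) + q))"
    using vec_of_block_indices[OF \<open>v \<in> carrier_vec (ns ! i)\<close>] by auto
  ultimately have "\<forall>k\<in>block_indices ns i. (\<Sum>l\<in>block_indices ns i. A $$ (k, l) * x l) = w k"
    by (simp only: diagonal_block_mult_vec_eq_iff)
  then show ?thesis by (intro exI[of _ x])
qed

end

section \<open>From M-matrices to nonnegative block triangular systems\<close>

lemma M_matrixE:
  assumes "M_matrix A" "A \<in> carrier_mat n n"
  obtains \<alpha> B where "0 < \<alpha>" "B \<in> carrier_mat n n" "\<And>i j. i < n \<Longrightarrow> j < n \<Longrightarrow> 0 \<le> B $$ (i, j)"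
    "spectral_radius (map_mat complex_of_real B) \<le> \<alpha>"
    "\<And>i j. i < n \<Longrightarrow> j < n \<Longrightarrow> A $$ (i, j) = (if i = j then \<alpha> else 0) - B $$ (i, j)"
proof -
  obtain \<alpha> B where B: "0 < \<alpha>" "B \<in> carrier_mat n n" "0\<^sub>m n n \<le> B"
    "spectral_radius (map_mat complex_of_real B) \<le> \<alpha>" "A = \<alpha> \<cdot>\<^sub>m 1\<^sub>m n - B"
    using assms unfolding M_matrix_def by auto
  show ?thesis
  proof (rule that[OF B(1,2) _ B(4)])
    show "0 \<le> B $$ (i, j)" if "i < n" "j < n" for i j
      using B(3) that unfolding less_eq_mat_def by auto
    show "A $$ (i, j) = (if i = j then \<alpha> else 0) - B $$ (i, j)" if "i < n" "j < n" for i j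
      using B(2) that unfolding B(5) by auto
  qed
qed

theorem theorem4:
  fixes A :: "real mat" and n :: nat and ns :: "nat list"
  assumes "n \<ge> 1"
    and "A \<in> carrier_mat n n"
    and "M_matrix A"
    and "frobenius_normal_form ns A"
  shows "(\<exists>u\<in>carrier_vec n. positive_vec u \<and> A *\<^sub>v u = 0\<^sub>v n) \<longleftrightarrow>
    (\<exists>i<length ns. \<not> invertible_mat (block ns A i i)) \<and>
    (\<forall>i<length ns. \<not> invertible_mat (block ns A i i) \<longrightarrow>
       (\<forall>j<length ns. j \<noteq> i \<longrightarrow> block ns A i j = 0\<^sub>m (ns ! i) (ns ! j))) \<and>
    (\<forall>i<length ns. invertible_mat (block ns A i i) \<longrightarrow>
       (\<exists>j<length ns. j \<noteq> i \<and> block ns A i j \<noteq> 0\<^sub>m (ns ! i) (ns ! j)))"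
proof -
  have A: "A \<in> carrier_mat (sum_list ns) (sum_list ns)" and pos: "\<And>m. m \<in> set ns \<Longrightarrow> 0 < m"
    and tri: "\<And>i j. i < length ns \<Longrightarrow> j < i \<Longrightarrow> block ns A i j = 0\<^sub>m (ns ! i) (ns ! j)"
    and irr: "\<And>i. i < length ns \<Longrightarrow> irreducible_mat (block ns A i i)"
    using assms(4) unfolding frobenius_normal_form_def block_upper_triangular_def by auto
  have n: "sum_list ns = n" using A assms(2) by auto
  obtain \<alpha> B where alpha: "0 < \<alpha>" and B: "B \<in> carrier_mat n n"
    and B0: "\<And>i j. i < n \<Longrightarrow> j < n \<Longrightarrow> 0 \<le> B $$ (i, j)"
    and rho: "spectral_radius (map_mat complex_of_real B) \<le> \<alpha>"
    and AB: "\<And>i j. i < n \<Longrightarrow> j < n \<Longrightarrow> A $$ (i, j) = (if i = j then \<alpha> else 0) - B $$ (i, j)"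
    using M_matrixE[OF assms(3,2)] by metis
  define b where "b k l = B $$ (k, l)" for k l
  let ?S = "block_indices ns"
  have sub: "?S i \<subseteq> {..<n}" for i using block_indices_subset[of ns i] n by simp
  have Un: "(\<Union>i<length ns. ?S i) = {..<n}" using UN_block_indices[of ns] n by simp
  have sum: "(\<Sum>l\<in>T. A $$ (k, l) * x l) = \<alpha> * x k - (\<Sum>l\<in>T. b k l * x l)"
    if T: "T \<subseteq> {..<n}" and k: "k \<in> T" for T k x
  proof -
    have "finite T" using T finite_subset by auto
    have "(\<Sum>l\<in>T. A $$ (k, l) * x l) = (\<Sum>l\<in>T. (if k = l then \<alpha> * x l else 0) - b k l * x l)"
      using T k by (intro sum.cong) (auto simp: AB b_def left_diff_distrib subset_eq)
    then show ?thesis using \<open>finite T\<close> k by (simp add: sum_subtractf)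
  qed
  have null: "(\<forall>k\<in>T. (\<Sum>l\<in>T. A $$ (k, l) * x l) = 0) \<longleftrightarrow> (\<forall>k\<in>T. (\<Sum>l\<in>T. b k l * x l) = \<alpha> * x k)"
    if T: "T \<subseteq> {..<n}" for T x
  proof (intro ball_cong refl)
    fix k assume "k \<in> T"
    show "(\<Sum>l\<in>T. A $$ (k, l) * x l) = 0 \<longleftrightarrow> (\<Sum>l\<in>T. b k l * x l) = \<alpha> * x k"
      unfolding sum[OF T \<open>k \<in> T\<close>] right_minus_eq by (rule eq_commute)
  qed
  \<comment> \<open>Distinct blocks have disjoint index sets, so \<open>\<alpha>\<close> does not
    enter and the off-diagonal blocks of \<open>A\<close> and \<open>- B\<close> agree.\<close>
  have zero: "block ns A i j = 0\<^sub>m (ns ! i) (ns ! j) \<longleftrightarrow> (\<forall>k\<in>?S i. \<forall>l\<in>?S j. b k l = 0)"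
    if ij: "i < length ns" "j < length ns" "j \<noteq> i" for i j
  proof -
    have "A $$ (k, l) = - b k l" if "k \<in> ?S i" "l \<in> ?S j" for k l
    proof -
      have "k \<noteq> l" "k < n" "l < n"
        using that block_indices_disjoint[OF ij(3), of ns] sub by (blast, auto)
      then show ?thesis using AB by (simp add: b_def)
    qed
    then show ?thesis unfolding block_eq_zero_iff[OF A ij(1,2)] by simp
  qed
  interpret block_triangular_nonneg ?S "length ns" b \<alpha>
  proof unfold_locales
    show "finite (?S i)" for i by (simp add: block_indices_def)
    show "?S i \<noteq> {}" if "i < length ns" for i using that pos[OF nth_mem[OF that]] by (simp add: block_indices_eq)
    show "?S i \<inter> ?S j = {}" if "i \<noteq> j" for i j by (rule block_indices_disjoint[OF that])
    show "0 \<le> b k l" if "k \<in> (\<Union>i<length ns. ?S i)" "l \<in> (\<Union>i<length ns. ?S i)" for k l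
      using that B0 unfolding Un b_def by auto
    show "b k l = 0" if "j < i" "i < length ns" "k \<in> ?S i" "l \<in> ?S j" for i j k l
      using zero[of i j] tri[of i j] that by auto
    show "0 \<le> \<alpha>" using alpha by simp
    show "\<forall>k\<in>\<Union>i<length ns. ?S i. x k = 0"
      if "\<alpha> < c" "\<And>k. k \<in> (\<Union>i<length ns. ?S i) \<Longrightarrow> 0 \<le> x k"
        "\<And>k. k \<in> (\<Union>i<length ns. ?S i) \<Longrightarrow> c * x k \<le> (\<Sum>l\<in>(\<Union>i<length ns. ?S i). b k l * x l)" for c x
      using subinvariant_vec_above_spectral_radius[OF B B0 rho alpha that(1), of x] that(2,3)
      unfolding Un b_def by auto
    show "Z = ?S i" if i: "i < length ns" and Z: "Z \<subseteq> ?S i" "Z \<noteq> {}"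
      and closed: "\<And>k l. k \<in> Z \<Longrightarrow> l \<in> ?S i - Z \<Longrightarrow> b k l = 0" for i Z
    proof -
      define s where "s = sum_list (take i ns)"
      have S: "?S i = (+) s ` {..<ns ! i}"
        using i by (simp add: block_indices_eq s_def lessThan_atLeast0 add.commute)
      \<comment> \<open>\<open>Z\<close> in the local coordinates of the block. For
        \<open>p \<in> Z'\<close> and \<open>q\<close> outside, \<open>p \<noteq> q\<close>, so the
        block entry is the negative of an entry of \<open>b\<close>.\<close>
      define Z' where "Z' = {p. p < ns ! i \<and> s + p \<in> Z}"
      have Z': "Z = (+) s ` Z'" using Z(1) unfolding Z'_def S by auto
      have "Z' = {..<ns ! i}"
      proof (rule irreducible_mat_closed_set[OF block_carrier[OF A i i] irr[OF i]])
        show "Z' \<subseteq> {..<ns ! i}" unfolding Z'_def by auto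
        show "Z' \<noteq> {}" using Z' Z(2) by auto
        fix p q assume pq: "p \<in> Z'" "q \<in> {..<ns ! i} - Z'"
        then have "s + p \<in> Z" "s + q \<in> ?S i - Z" "p \<noteq> q" "p < ns ! i" "q < ns ! i"
          unfolding Z'_def S by auto
        moreover from this have "s + p < n" "s + q < n" using sub[of i] Z(1) by auto
        ultimately show "block ns A i i $$ (p, q) = 0"
          using closed[of "s + p" "s + q"] AB[of "s + p" "s + q"] block_index[OF A i i, of p q]
          by (simp add: b_def s_def)
      qed
      then show ?thesis using Z' S by simp
    qed
  qed
  have I: "I = {..<n}" unfolding I_def by (rule Un)
  have reg: "regular i \<longleftrightarrow> invertible_mat (block ns A i i)" if i: "i < length ns" for i
    unfolding regular_def invertible_diagonal_block_iff[OF A i] null[OF sub] ..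
  have "(\<exists>u\<in>carrier_vec n. positive_vec u \<and> A *\<^sub>v u = 0\<^sub>v n) \<longleftrightarrow>
      (\<exists>u. \<forall>k<n. 0 < u k \<and> (\<Sum>l<n. A $$ (k, l) * u l) = 0)" (is "?L \<longleftrightarrow> ?R")
  proof
    assume ?L
    then obtain u where u: "u \<in> carrier_vec n" "positive_vec u" "A *\<^sub>v u = 0\<^sub>v n" by auto
    have "(\<Sum>l<n. A $$ (k, l) * u $ l) = 0" if "k < n" for k
      using arg_cong[OF u(3), of "\<lambda>v. v $ k"] u(1) assms(2) that
      by (simp add: scalar_prod_def lessThan_atLeast0)
    then show ?R using u unfolding positive_vec_def by (intro exI[of _ "\<lambda>k. u $ k"]) auto
  next
    assume ?R
    then obtain u where u: "\<forall>k<n. 0 < u k \<and> (\<Sum>l<n. A $$ (k, l) * u l) = 0" by auto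
    have "A *\<^sub>v vec n u = 0\<^sub>v n"
      using u assms(2) by (intro eq_vecI) (auto simp: scalar_prod_def lessThan_atLeast0)
    then show ?L using u unfolding positive_vec_def by (intro bexI[of _ "vec n u"]) auto
  qed
  also have "\<dots> \<longleftrightarrow> (\<exists>u. \<forall>k\<in>I. 0 < u k \<and> (\<Sum>l\<in>I. b k l * u l) = \<alpha> * u k)"
    unfolding I ball_conj_distrib null[OF subset_refl, symmetric] by (auto simp: Ball_def)
  also have "\<dots> \<longleftrightarrow> (\<exists>i<length ns. \<not> regular i) \<and>
    (\<forall>i<length ns. \<not> regular i \<longrightarrow> (\<forall>j<length ns. j \<noteq> i \<longrightarrow> (\<forall>k\<in>?S i. \<forall>l\<in>?S j. b k l = 0))) \<and>
    (\<forall>i<length ns. regular i \<longrightarrow> (\<exists>j<length ns. j \<noteq> i \<and> \<not> (\<forall>k\<in>?S i. \<forall>l\<in>?S j. b k l = 0)))"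
  proof (rule ex_positive_null_vector_iff)
    \<comment> \<open>The assumption \<open>n \<ge> 1\<close> guarantees at least one block.\<close>
    show "0 < length ns" using n assms(1) by (cases ns) auto
    fix i w assume i: "i < length ns" "regular i"
    then obtain x where x: "\<forall>k\<in>?S i. (\<Sum>l\<in>?S i. A $$ (k, l) * x l) = w k"
      using reg invertible_diagonal_block_imp_solvable[OF A i(1)] by blast
    show "\<exists>x. \<forall>k\<in>?S i. \<alpha> * x k = (\<Sum>l\<in>?S i. b k l * x l) + w k"
    proof (intro exI ballI)
      fix k assume k: "k \<in> ?S i"
      show "\<alpha> * x k = (\<Sum>l\<in>?S i. b k l * x l) + w k" using x k sum[OF sub k, of x] by simp
    qed
  qed
  finally show ?thesis using reg zero by (simp cong: conj_cong)
qed

end
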